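(* Let $n\ge1$, $k\ge 1$, let $\mathbf C_n\subset SU_2$ be the cyclic group of order $n$ acting on $V=\mathbb C^2$, let $Z_k(\mathbf C_n)=\mathrm{End}_{\mathbf C_n}(V^{\otimes k})$, and let $\tilde n=n$ if $n$ is odd, $\tilde n=n/2$ if $n$ is even. (a) The set $\mathcal B^k(\mathbf C_n)=\{\mathsf E_{\mathsf r,\mathsf s}\mid\mathsf r,\mathsf s\in\{-1,1\}^k,\ |\mathsf r|\equiv|\mathsf s|\bmod\tilde n\}$ is a basis of $Z_k(\mathbf C_n)$. (b) The set $\{z_\ell\mid\ell\in\Lambda_k(\mathbf C_n)\}$ is a basis for the center of $Z_k(\mathbf C_n)$, where $$z_\ell=\sum_{\mathsf r\in\{-1,1\}^k,\ k-2|\mathsf r|\equiv\ell\bmod n}\mathsf E_{\mathsf r,\mathsf r}\qquad\text{for }\ell\in\Lambda_k(\mathbf C_n).$$ (c) If $n=2\tilde n$ and $\tilde n$ is odd, then $Z_k(\mathbf C_n)\cong Z_k(\mathbf C_{\tilde n})$. (d) The dimension of $Z_k(\mathbf C_n)$ is the coefficient of $z^k$ in $(1+z)^{2k}\big|_{z^{\tilde n}=1}$; hence $$\dim Z_k(\mathbf C_n)=\sum_{\substack{0\le a,b\le k\\ a\equiv b\bmod\tilde n}}\binom ka\binom kb .$$ (e) The number of walks of $2k$ steps from $0$ to $0$ on a circular graph with $n$ nodes (i.e., on the affine Dynkin diagram of type $\hat{\mathsf A}_{n-1}$) is $\displaystyle\sum_{\substack{0\le a,b\le k\\ a\equiv b\bmod\tilde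 n}}\binom ka\binom kb$.
   Context: $\mathbf C_n$ is the subgroup of $SU_2$ generated by $g=\mathrm{diag}(\zeta^{-1},\zeta)$, $\zeta$ a primitive $n$th root of unity. $V=\mathbb C^2$ has basis $v_{-1}=(1,0)^t$, $v_1=(0,1)^t$, and $\mathbf C_n$ acts diagonally on $V^{\otimes k}$. For $\mathsf r=(r_1,\dots,r_k)\in\{-1,1\}^k$: $v_{\mathsf r}=v_{r_1}\otimes\cdots\otimes v_{r_k}$ and $|\mathsf r|$ is the number of indices $i$ with $r_i=-1$. $\mathsf E_{\mathsf r,\mathsf s}$ is the matrix unit $\mathsf E_{\mathsf r,\mathsf s}v_{\mathsf t}=\delta_{\mathsf s,\mathsf t}v_{\mathsf r}$. The irreducible modules of $\mathbf C_n$ are labeled by $\ell\in\{0,1,\dots,n-1\}$, $g$ acting by $\zeta^\ell$, and $\Lambda_k(\mathbf C_n)=\{\ell\in\{0,\dots,n-1\}\mid\ell\equiv k-2a\bmod n\text{ for some }a\in\{0,1,\dots,k\}\}$ labels those occurring in $V^{\otimes k}$. The notation $(1+z)^{2k}|_{z^{\tilde n}=1}$ means the image of $(1+z)^{2k}$ in $\mathbb C[z]/(z^{\tilde n}-1)$, exponents being read modulo $\tilde n$. The circular graph has nodes $0,1,\dots,n-1$, and each step of a walk goes from $j$ to $j+1$ or to $j-1$ modulo $n$; walks are counted as sequences of such $\pm1$ steps (for $n\ge3$ this is the usual notion of walk). *)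

theory Defs
  imports
    "HOL-Analysis.Analysis"
    "HOL-Algebra.Multiplicative_Group"
    "HOL-Computational_Algebra.Polynomial"
    "HOL-Number_Theory.Cong"
    "HOL-Library.Function_Algebras"
begin

section \<open>The cyclic group inside \<open>SU\<^sub>2\<close>\<close>

text \<open>The index set \<open>{-1, 1}\<close>; \<open>V = \<complex>\<^sup>2\<close> is \<open>complex ^ sign\<close>, with first coordinate \<open>MinusOne\<close>.\<close>

datatype sign = MinusOne | PlusOne

lemma UNIV_sign: "UNIV = {MinusOne, PlusOne}"
proof -
  have "i \<in> {MinusOne, PlusOne}" for i
    by (cases i) simp_all
  then show ?thesis by blast
qed

instance sign :: finite
  by standard (simp add: UNIV_sign)

definition adjoint_mat :: "complex ^ 'i ^ 'i \<Rightarrow> complex ^ 'i ^ 'i" where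
  "adjoint_mat A = (\<chi> i j. cnj (A $ j $ i))"

definition SU2 :: "(complex ^ sign ^ sign) monoid" where
  "SU2 = \<lparr>carrier = {A. A ** adjoint_mat A = mat 1 \<and> det A = 1}, mult = (**), one = mat 1\<rparr>"

definition primitive_root :: "nat \<Rightarrow> complex \<Rightarrow> bool" where
  "primitive_root n \<zeta> \<longleftrightarrow> 0 < n \<and> \<zeta> ^ n = 1 \<and> (\<forall>m. 0 < m \<and> m < n \<longrightarrow> \<zeta> ^ m \<noteq> 1)"

definition cyc_gen :: "complex \<Rightarrow> complex ^ sign ^ sign" where
  "cyc_gen \<zeta> = (\<chi> i j. if i = j then (case i of MinusOne \<Rightarrow> inverse \<zeta> | PlusOne \<Rightarrow> \<zeta>) else 0)"

definition cyc :: "complex \<Rightarrow> (complex ^ sign ^ sign) set" where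
  "cyc \<zeta> = generate SU2 {cyc_gen \<zeta>}"

lemma adjoint_mat_mult: "adjoint_mat (A ** B) = adjoint_mat B ** adjoint_mat A"
  by (simp add: adjoint_mat_def matrix_matrix_mult_def vec_eq_iff mult.commute)

lemma adjoint_mat_adjoint_mat: "adjoint_mat (adjoint_mat A) = A"
  by (simp add: adjoint_mat_def vec_eq_iff)

lemma group_SU2: "group SU2"
proof (rule groupI)
  fix A B assume "A \<in> carrier SU2" "B \<in> carrier SU2"
  then have A: "A ** adjoint_mat A = mat 1" "det A = 1"
    and B: "B ** adjoint_mat B = mat 1" "det B = 1"
    by (simp_all add: SU2_def)
  have "A ** B ** adjoint_mat (A ** B) = A ** (B ** adjoint_mat B) ** adjoint_mat A"
    by (simp add: adjoint_mat_mult matrix_mul_assoc)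
  with A B show "A \<otimes>\<^bsub>SU2\<^esub> B \<in> carrier SU2"
    by (simp add: SU2_def det_mul)
next
  have "adjoint_mat (mat 1) = (mat 1 :: complex ^ sign ^ sign)"
    by (auto simp: adjoint_mat_def mat_def vec_eq_iff)
  then show "\<one>\<^bsub>SU2\<^esub> \<in> carrier SU2"
    by (simp add: SU2_def)
next
  fix A assume "A \<in> carrier SU2"
  then have A: "A ** adjoint_mat A = mat 1" "det A = 1"
    by (simp_all add: SU2_def)
  then have A': "adjoint_mat A ** A = mat 1"
    by (simp add: matrix_left_right_inverse)
  have "det (adjoint_mat A) = 1"
    using A by (metis det_I det_mul mult_1)
  with A A' show "\<exists>B\<in>carrier SU2. B \<otimes>\<^bsub>SU2\<^esub> A = \<one>\<^bsub>SU2\<^esub>"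
    by (intro bexI[of _ "adjoint_mat A"]) (auto simp: SU2_def adjoint_mat_adjoint_mat)
qed (auto simp: SU2_def matrix_mul_assoc)

lemma cyc_gen_1: "cyc_gen 1 = mat 1"
  by (auto simp: cyc_gen_def mat_def vec_eq_iff split: sign.split)

lemma cyc_gen_mult: "cyc_gen x ** cyc_gen y = cyc_gen (x * y)"
proof -
  have "(cyc_gen x ** cyc_gen y) $ i $ j = cyc_gen (x * y) $ i $ j" for i j
    by (cases i; cases j) (simp_all add: cyc_gen_def matrix_matrix_mult_def UNIV_sign)
  then show ?thesis by (simp add: vec_eq_iff)
qed

lemma cyc_gen_eq_iff: "cyc_gen x = cyc_gen y \<longleftrightarrow> x = y"
proof
  assume "cyc_gen x = cyc_gen y"
  then have "cyc_gen x $ PlusOne $ PlusOne = cyc_gen y $ PlusOne $ PlusOne" by simp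
  then show "x = y" by (simp add: cyc_gen_def)
qed simp

lemma cyc_gen_pow: "cyc_gen x [^]\<^bsub>SU2\<^esub> (m::nat) = cyc_gen (x ^ m)"
proof -
  interpret group SU2 by (rule group_SU2)
  show ?thesis
  proof (induction m)
    case 0
    have "\<one>\<^bsub>SU2\<^esub> = mat 1" by (simp add: SU2_def)
    then show ?case by (simp add: cyc_gen_1)
  next
    case (Suc m)
    have "cyc_gen x [^]\<^bsub>SU2\<^esub> Suc m = cyc_gen (x ^ m) ** cyc_gen x"
      using Suc by (simp add: SU2_def)
    then show ?case by (simp add: cyc_gen_mult mult.commute)
  qed
qed

lemma cyc_gen_in_SU2:
  assumes "norm x = 1"
  shows "cyc_gen x \<in> carrier SU2"
proof -
  have xc: "x * cnj x = 1"
    using assms complex_norm_square[of x] by simp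
  then have x: "x \<noteq> 0" "inverse x = cnj x"
    by (auto simp: inverse_unique)
  have "adjoint_mat (cyc_gen x) = cyc_gen (cnj x)"
    by (auto simp: adjoint_mat_def cyc_gen_def vec_eq_iff split: sign.split)
  moreover have "det (cyc_gen x) = prod (\<lambda>i. cyc_gen x $ i $ i) UNIV"
    by (rule det_diagonal) (simp add: cyc_gen_def)
  ultimately show ?thesis
    using x xc by (simp add: SU2_def cyc_gen_mult cyc_gen_1 UNIV_sign) (simp add: cyc_gen_def mult.commute)
qed

lemma card_cyc:
  assumes "primitive_root n \<zeta>"
  shows "card (cyc \<zeta>) = n"
proof -
  interpret group SU2 by (rule group_SU2)
  have n: "0 < n" "\<zeta> ^ n = 1" and min: "\<And>m. 0 < m \<Longrightarrow> m < n \<Longrightarrow> \<zeta> ^ m \<noteq> 1"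
    using assms by (auto simp: primitive_root_def)
  have "norm \<zeta> ^ n = 1 ^ n"
    using n by (simp flip: norm_power)
  then have "norm \<zeta> = 1"
    using n by (metis power_eq_imp_eq_base norm_ge_zero zero_le_one)
  then have g: "cyc_gen \<zeta> \<in> carrier SU2"
    by (rule cyc_gen_in_SU2)
  have pow: "cyc_gen \<zeta> [^]\<^bsub>SU2\<^esub> m = \<one>\<^bsub>SU2\<^esub> \<longleftrightarrow> \<zeta> ^ m = 1" for m :: nat
  proof -
    have "\<one>\<^bsub>SU2\<^esub> = cyc_gen 1" by (simp add: SU2_def cyc_gen_1)
    then show ?thesis by (simp add: cyc_gen_pow cyc_gen_eq_iff)
  qed
  have "ord (cyc_gen \<zeta>) dvd n"
    using pow_eq_id[OF g] pow n by blast
  moreover have "\<zeta> ^ ord (cyc_gen \<zeta>) = 1"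
    using pow pow_ord_eq_1[OF g] by blast
  ultimately have "ord (cyc_gen \<zeta>) = n"
    using min n by (metis dvd_imp_le dvd_pos_nat le_neq_implies_less)
  then show ?thesis
    using generate_pow_card[OF g] by (simp add: cyc_def)
qed


section \<open>The tensor power and its endomorphisms\<close>

text \<open>
  The \<open>k\<close> tensor factors are indexed by a finite type \<open>'k\<close> with \<open>k\<close> elements.  The tensor power of
  \<open>V\<close> is the space of coordinate vectors indexed by the sign patterns \<open>r :: 'k \<Rightarrow> sign\<close>, where
  \<open>axis r 1\<close> is the basis tensor \<open>v\<^sub>r\<close> (see \<open>pure_tensor_axis\<close> below).
\<close>

type_synonym 'k pattern = "'k \<Rightarrow> sign"
type_synonym 'k tensor = "complex ^ ('k \<Rightarrow> sign)"
type_synonym 'k endo = "complex ^ ('k \<Rightarrow> sign) \<Rightarrow> complex ^ ('k \<Rightarrow> sign)"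

definition pure_tensor :: "('k::finite \<Rightarrow> complex ^ sign) \<Rightarrow> 'k tensor" where
  "pure_tensor u = (\<chi> r. \<Prod>i\<in>UNIV. u i $ r i)"

text \<open>The diagonal action: the matrix of \<open>A \<otimes> \<dots> \<otimes> A\<close>, characterised by \<open>diag_act_pure_tensor\<close>.\<close>

definition diag_act :: "complex ^ sign ^ sign \<Rightarrow> 'k::finite endo" where
  "diag_act A x = (\<chi> r s. \<Prod>i\<in>UNIV. A $ r i $ s i) *v x"

lemma pure_tensor_axis: "pure_tensor (\<lambda>i. axis (r i) 1) = axis (r :: 'k::finite pattern) 1"
proof -
  have "(\<Prod>i\<in>UNIV. if s i = r i then 1 else 0) = (if s = r then 1 else (0::complex))"
    for s :: "'k pattern"
    by (auto simp: fun_eq_iff)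
  then show ?thesis
    by (simp add: pure_tensor_def axis_def vec_eq_iff eq_commute)
qed

lemma diag_act_pure_tensor:
  "diag_act A (pure_tensor u) = pure_tensor (\<lambda>i :: 'k::finite. A *v u i)"
proof -
  have "(\<Sum>s\<in>UNIV. (\<Prod>i\<in>UNIV. A $ r i $ s i) * (\<Prod>i\<in>UNIV. u i $ s i))
      = (\<Prod>i\<in>UNIV. \<Sum>j\<in>UNIV. A $ r i $ j * u i $ j)" for r :: "'k pattern"
    using prod_sum_PiE[of "UNIV :: 'k set" "\<lambda>_. UNIV :: sign set" "\<lambda>i j. A $ r i $ j * u i $ j"]
    by (simp add: prod.distrib)
  then show ?thesis
    by (simp add: diag_act_def pure_tensor_def matrix_vector_mult_def vec_eq_iff)
qed

text \<open>
  Sums of endomorphisms are pointwise; the product is composition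
  (not the pointwise product of \<open>Function_Algebras\<close>).
\<close>

definition scale_endo :: "complex \<Rightarrow> 'k::finite endo \<Rightarrow> 'k endo" where
  "scale_endo c f = (\<lambda>x. c *s f x)"

interpretation endo: vector_space "scale_endo :: complex \<Rightarrow> 'k::finite endo \<Rightarrow> 'k endo"
  by standard (auto simp: scale_endo_def fun_eq_iff vec_eq_iff algebra_simps)

definition is_basis :: "'k::finite endo set \<Rightarrow> 'k endo set \<Rightarrow> bool" where
  "is_basis B W \<longleftrightarrow> B \<subseteq> W \<and> endo.independent B \<and> endo.span B = W"

definition End_cyc :: "complex \<Rightarrow> 'k::finite endo set" where
  "End_cyc \<zeta> = {f. Vector_Spaces.linear (*s) (*s) f \<and> (\<forall>A\<in>cyc \<zeta>. f \<circ> diag_act A = diag_act A \<circ> f)}"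

definition center :: "'k::finite endo set \<Rightarrow> 'k endo set" where
  "center W = {f \<in> W. \<forall>h\<in>W. f \<circ> h = h \<circ> f}"

definition alg_iso :: "'k::finite endo set \<Rightarrow> 'k endo set \<Rightarrow> bool" where
  "alg_iso W W' \<longleftrightarrow> (\<exists>\<phi>. bij_betw \<phi> W W' \<and> \<phi> id = id \<and>
     (\<forall>f\<in>W. \<forall>h\<in>W. \<phi> (f + h) = \<phi> f + \<phi> h \<and> \<phi> (f \<circ> h) = \<phi> f \<circ> \<phi> h) \<and>
     (\<forall>c. \<forall>f\<in>W. \<phi> (scale_endo c f) = scale_endo c (\<phi> f)))"

definition matrix_unit :: "'k::finite pattern \<Rightarrow> 'k pattern \<Rightarrow> 'k endo" where
  "matrix_unit r s = (\<lambda>x. x $ s *s axis r 1)"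

lemma matrix_unit_axis: "matrix_unit r s (axis t 1) = (if s = t then axis r 1 else 0)"
  by (auto simp: matrix_unit_def axis_def vec_eq_iff)

text \<open>\<open>weight r\<close> is \<open>|r|\<close>.\<close>

definition weight :: "'k::finite pattern \<Rightarrow> nat" where
  "weight r = card {i. r i = MinusOne}"

definition ntilde :: "nat \<Rightarrow> nat" where
  "ntilde n = (if odd n then n else n div 2)"

definition Lambda :: "nat \<Rightarrow> nat \<Rightarrow> nat set" where
  "Lambda n k = {l \<in> {0..<n}. \<exists>a\<in>{0..k}. [int l = int k - 2 * int a] (mod int n)}"

definition central_elt :: "nat \<Rightarrow> nat \<Rightarrow> 'k::finite endo" where
  "central_elt n l = (\<Sum>r | [int CARD('k) - 2 * int (weight r) = int l] (mod int n). matrix_unit r r)"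


section \<open>Counting\<close>

text \<open>
  The image of \<open>p\<close> in \<open>\<complex>[z]/(z\<^sup>m - 1)\<close>, given by its representative of degree less than \<open>m\<close>;
  exponents being read modulo \<open>m\<close>, the coefficient of \<open>z\<^sup>k\<close> is the one at \<open>k mod m\<close>.
\<close>

definition coeff_cyclic :: "nat \<Rightarrow> complex poly \<Rightarrow> nat \<Rightarrow> complex" where
  "coeff_cyclic m p k = Polynomial.coeff (p mod (Polynomial.monom 1 m - 1)) (k mod m)"

definition circle_step :: "nat \<Rightarrow> int \<Rightarrow> int \<Rightarrow> int" where
  "circle_step n j d = (j + d) mod int n"

text \<open>
  Walks are sequences of steps, so the two steps of the circle with \<open>n \<le> 2\<close> nodes that lead to the
  same node count separately.
\<close>

definition circle_walks :: "nat \<Rightarrow> nat \<Rightarrow> int \<Rightarrow> int \<Rightarrow> int list set" where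
  "circle_walks n m i j =
     {ds. length ds = m \<and> set ds \<subseteq> {-1, 1} \<and> foldl (circle_step n) i ds = j}"

definition binom_sum :: "nat \<Rightarrow> nat \<Rightarrow> nat" where
  "binom_sum m k =
     (\<Sum>(a, b) | a \<le> k \<and> b \<le> k \<and> [a = b] (mod m). (k choose a) * (k choose b))"

end

theory Submission
  imports Defs
begin

text \<open>
  The generator \<open>diag(\<zeta>\<inverse>, \<zeta>)\<close> acts on the basis tensor \<open>v\<^sub>r\<close> by the scalar \<open>\<zeta>\<^bsup>k - 2|r|\<^esup>\<close>.
  An endomorphism therefore commutes with the group exactly when its matrix entry at \<open>(r, s)\<close>
  vanishes unless \<open>k - 2|r| \<equiv> k - 2|s|\<close> modulo \<open>n\<close>.  The factor \<open>2\<close> turns the modulus \<open>n\<close>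
  into \<open>ntilde n\<close>, so the condition is \<open>|r| \<equiv> |s|\<close> modulo \<open>ntilde n\<close>
  (\<open>End_cyc_eq_block_algebra\<close>): in a suitable ordering of the basis the centralizer consists of
  all block diagonal matrices, with one block for each residue class of weights.

  The structural statements hold for block diagonal matrices with any labelling of the
  blocks.  The matrix units inside the blocks form a basis, and the identity matrices of the
  blocks form a basis of the center (\<open>basis_block_algebra\<close>, \<open>basis_center_block_algebra\<close>);
  the \<open>z\<^sub>l\<close> are these block identities, since the weights take all values from \<open>0\<close> to \<open>k\<close>.
  If \<open>ntilde n\<close> is odd then \<open>ntilde (ntilde n) = ntilde n\<close>, so the groups of orders
  \<open>2 \<cdot> ntilde n\<close> and \<open>ntilde n\<close> have literally the same centralizer.

  The dimension counts pairs of patterns with congruent weights, and there are \<open>k choose a\<close>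
  patterns of weight \<open>a\<close>; this is the double binomial sum.  By Vandermonde's identity, after
  replacing \<open>b\<close> by \<open>k - b\<close>, that sum is also the sum of \<open>2k choose j\<close> over all \<open>j \<equiv> k\<close> modulo
  \<open>ntilde n\<close> (\<open>binom_sum_eq_sum_choose\<close>).  In this single-sum form it is visibly both the
  coefficient of \<open>z\<^sup>k\<close> in the reduced polynomial and the number of closed walks, a
  walk with \<open>j\<close> negative steps being closed if and only if \<open>n\<close> divides \<open>2k - 2j\<close>.
\<close>

section \<open>Endomorphisms respecting a partition of the basis tensors\<close>

lemma sum_endo_apply: "(\<Sum>i\<in>I. F i) x = (\<Sum>i\<in>I. F i x)"
  by (induction I rule: infinite_finite_induct) auto

lemma matrix_unit_nth: "matrix_unit r s x $ t = (if t = r then x $ s else 0)"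
  by (simp add: matrix_unit_def axis_def)

lemma linear_vec_iff:
  "Vector_Spaces.linear (*s) (*s) (f :: 'a::field ^ 'n \<Rightarrow> 'a ^ 'm) \<longleftrightarrow>
    (\<forall>x y. f (x + y) = f x + f y) \<and> (\<forall>c x. f (c *s x) = c *s f x)"
  by (simp add: Vector_Spaces.linear_def module_hom_axioms_def vec.vector_space_axioms
      module_hom_def vec.module_axioms)

lemma linear_nth:
  fixes f :: "'k::finite endo"
  assumes "Vector_Spaces.linear (*s) (*s) f"
  shows "f x $ r = (\<Sum>s\<in>UNIV. matrix f $ r $ s * x $ s)"
  by (subst matrix_works[OF assms, symmetric]) (simp add: matrix_vector_mult_def)

lemma matrix_nth: "matrix f $ r $ s = f (axis s 1) $ r"
  by (simp add: matrix_def)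

text \<open>
  Two basis tensors lie in the same block when \<open>p\<close> gives them the same label.  Every product of
  full matrix algebras along a partition of the basis arises in this way.
\<close>

definition block_algebra :: "('k::finite pattern \<Rightarrow> 'c) \<Rightarrow> 'k endo set" where
  "block_algebra p = {f. Vector_Spaces.linear (*s) (*s) f \<and>
     (\<forall>r s. p r \<noteq> p s \<longrightarrow> matrix f $ r $ s = 0)}"

lemma linear_matrix_unit:
  "Vector_Spaces.linear (*s) (*s) (matrix_unit r s :: 'k::finite endo)"
  by unfold_locales (auto simp: matrix_unit_def vec_eq_iff algebra_simps axis_def)

lemma matrix_matrix_unit:
  "matrix (matrix_unit r s) $ t $ u = (if t = r \<and> u = s then 1 else 0)"
  by (simp add: matrix_nth matrix_unit_nth axis_def)

lemma subspace_linear: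
  "endo.subspace {f :: 'k::finite endo. Vector_Spaces.linear (*s) (*s) f}"
  by (rule endo.subspaceI)
    (auto simp: linear_vec_iff scale_endo_def vec_eq_iff algebra_simps)

lemma subspace_block_algebra: "endo.subspace (block_algebra p :: 'k::finite endo set)"
  using subspace_linear[where 'k = 'k] unfolding endo.subspace_def
  by (auto simp: block_algebra_def matrix_nth scale_endo_def)

lemma linear_eq_sum_matrix_unit:
  fixes f :: "'k::finite endo"
  assumes "Vector_Spaces.linear (*s) (*s) f"
  shows "f = (\<Sum>(r, s)\<in>UNIV. scale_endo (matrix f $ r $ s) (matrix_unit r s))"
proof -
  have "f x $ t = (\<Sum>(r, s)\<in>UNIV. scale_endo (matrix f $ r $ s) (matrix_unit r s)) x $ t" for x t
  proof -
    have "(\<Sum>(r, s)\<in>UNIV. scale_endo (matrix f $ r $ s) (matrix_unit r s)) x $ t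
        = (\<Sum>r\<in>UNIV. \<Sum>s\<in>UNIV. if t = r then matrix f $ r $ s * x $ s else 0)"
      by (simp add: sum_endo_apply case_prod_unfold scale_endo_def matrix_unit_nth
          sum.cartesian_product if_distrib cong: if_cong)
    also have "\<dots> = (\<Sum>r\<in>UNIV. if t = r then \<Sum>s\<in>UNIV. matrix f $ r $ s * x $ s else 0)"
      by (intro sum.cong) auto
    finally show ?thesis
      by (simp add: linear_nth[OF assms])
  qed
  then show ?thesis
    by (simp add: fun_eq_iff vec_eq_iff)
qed

lemma inj_matrix_unit: "inj (\<lambda>(r, s). matrix_unit r s :: 'k::finite endo)"
proof (rule injI, clarify)
  fix r s t u :: "'k pattern"
  assume "(matrix_unit r s :: 'k endo) = matrix_unit t u"
  then have "matrix (matrix_unit r s :: 'k endo) $ r $ s = matrix (matrix_unit t u) $ r $ s"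
    by simp
  then show "r = t \<and> s = u"
    by (simp add: matrix_matrix_unit split: if_splits)
qed

lemma independent_matrix_unit:
  "endo.independent (range (\<lambda>(r, s). matrix_unit r s :: 'k::finite endo))"
proof (rule endo.independent_if_scalars_zero)
  fix c and e :: "'k endo"
  assume 0: "(\<Sum>e\<in>range (\<lambda>(r, s). matrix_unit r s :: 'k endo). scale_endo (c e) e) = 0"
    and e: "e \<in> range (\<lambda>(r, s). matrix_unit r s :: 'k endo)"
  from e obtain r s where e: "e = matrix_unit r s" by auto
  have "0 = (\<Sum>e\<in>range (\<lambda>(r, s). matrix_unit r s :: 'k endo). scale_endo (c e) e) (axis s 1) $ r"
    by (simp add: 0)
  also have "\<dots> = (\<Sum>q\<in>UNIV. if q = (r, s) then c (matrix_unit r s) else 0)"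
    unfolding sum.reindex[OF inj_matrix_unit] sum_endo_apply sum_component
    by (intro sum.cong refl) (auto simp: scale_endo_def matrix_unit_nth axis_def split: if_splits)
  finally show "c e = 0" by (simp add: e)
qed simp

lemma basis_block_algebra:
  "is_basis {matrix_unit r s | r s. p r = p s} (block_algebra p :: 'k::finite endo set)"
proof -
  let ?B = "{matrix_unit r s | r s. p r = p s} :: 'k endo set"
  have sub: "?B \<subseteq> block_algebra p"
    by (auto simp: block_algebra_def linear_matrix_unit matrix_matrix_unit)
  have ind: "endo.independent ?B"
    by (rule endo.independent_mono[OF independent_matrix_unit]) auto
  have "f \<in> endo.span ?B" if f: "f \<in> block_algebra p" for f :: "'k endo"
  proof -
    have "(\<Sum>(r, s)\<in>UNIV. scale_endo (matrix f $ r $ s) (matrix_unit r s)) \<in> endo.span ?B"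
    proof (rule endo.span_sum, clarify)
      fix r s :: "'k pattern"
      show "scale_endo (matrix f $ r $ s) (matrix_unit r s) \<in> endo.span ?B"
      proof (cases "p r = p s")
        case True
        then show ?thesis by (intro endo.span_scale endo.span_base) auto
      next
        case False
        then show ?thesis using f by (simp add: block_algebra_def endo.span_zero)
      qed
    qed
    with f linear_eq_sum_matrix_unit[of f] show ?thesis
      by (simp add: block_algebra_def)
  qed
  with endo.span_minimal[OF sub subspace_block_algebra] sub ind show ?thesis
    by (auto simp: is_basis_def)
qed

text \<open>The basis is counted through its index pairs, since distinct pairs give distinct matrix units.\<close>

lemma dim_block_algebra:
  fixes p :: "'k::finite pattern \<Rightarrow> 'c"
  shows "endo.dim (block_algebra p) = card {(r, s). p r = p s}"
proof -
  let ?B = "{matrix_unit r s | r s. p r = p s} :: 'k endo set"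
  have "endo.dim (block_algebra p) = card ?B"
    using basis_block_algebra[of p] endo.basis_card_eq_dim[of ?B "block_algebra p"]
    by (simp add: is_basis_def)
  also have "?B = (\<lambda>(r, s). matrix_unit r s) ` {(r, s). p r = p s}" by auto
  also have "card \<dots> = card {(r, s). p r = p s}"
    by (intro card_image inj_on_subset[OF inj_matrix_unit]) simp
  finally show ?thesis .
qed

definition block_projection :: "('k::finite pattern \<Rightarrow> 'c) \<Rightarrow> 'c \<Rightarrow> 'k endo" where
  "block_projection p c = (\<Sum>r | p r = c. matrix_unit r r)"

lemma block_projection_nth: "block_projection p c x $ r = (if p r = c then x $ r else 0)"
  by (simp add: block_projection_def sum_endo_apply matrix_unit_nth)

lemma linear_diagonal:
  assumes "\<And>x r. (f :: 'k::finite endo) x $ r = c r * x $ r"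
  shows "Vector_Spaces.linear (*s) (*s) f"
  by (auto simp: linear_vec_iff assms vec_eq_iff algebra_simps)

text \<open>
  Commuting with the matrix unit at \<open>(r, r)\<close> makes \<open>f\<close> diagonal, and commuting with the one at
  \<open>(r, s)\<close> makes the diagonal entries at \<open>r\<close> and \<open>s\<close> equal.  A block scalar endomorphism in turn
  commutes with every matrix that has no entries between different blocks.
\<close>

lemma center_block_algebra:
  fixes p :: "'k::finite pattern \<Rightarrow> 'c"
  shows "center (block_algebra p) = {f. \<exists>c. \<forall>x r. f x $ r = c (p r) * x $ r}"
proof (intro equalityI subsetI)
  fix f assume f: "f \<in> center (block_algebra p)"
  then have lin: "Vector_Spaces.linear (*s) (*s) f"
    by (simp add: center_def block_algebra_def)
  have comm: "f (axis r 1) $ t = (if t = r then f (axis s 1) $ s else 0)"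
    if "p r = p s" for r s t
  proof -
    have "matrix_unit r s \<in> block_algebra p"
      using basis_block_algebra[of p] that by (auto simp: is_basis_def)
    then have "f \<circ> matrix_unit r s = matrix_unit r s \<circ> f"
      using f unfolding center_def by blast
    then have "f (matrix_unit r s (axis s 1)) = matrix_unit r s (f (axis s 1))"
      by (metis comp_apply)
    then show ?thesis
      by (simp add: matrix_unit_axis matrix_unit_nth)
  qed
  define d where "d r = f (axis r 1) $ r" for r
  have d: "d r = d s" if "p r = p s" for r s
    using comm[OF that, of r] by (simp add: d_def)
  have diag: "f (axis s 1) $ r = (if r = s then d s else 0)" for r s
    unfolding d_def by (rule comm[OF refl])
  \<comment> \<open>The scalar of a block is read off at an arbitrary representative of that block.\<close>
  have "f x $ r = d (inv_into UNIV p (p r)) * x $ r" for x r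
  proof -
    have "f x $ r = (\<Sum>s\<in>UNIV. matrix f $ r $ s * x $ s)"
      by (rule linear_nth[OF lin])
    also have "\<dots> = (\<Sum>s\<in>UNIV. if s = r then d r * x $ s else 0)"
      by (intro sum.cong refl) (simp add: matrix_nth diag)
    also have "\<dots> = d r * x $ r" by simp
    also have "d r = d (inv_into UNIV p (p r))"
      by (rule d) (simp add: f_inv_into_f)
    finally show ?thesis .
  qed
  then show "f \<in> {f. \<exists>c. \<forall>x r. f x $ r = c (p r) * x $ r}"
    by (auto intro!: exI[of _ "\<lambda>a. d (inv_into UNIV p a)"])
next
  fix f :: "'k endo" assume "f \<in> {f. \<exists>c. \<forall>x r. f x $ r = c (p r) * x $ r}"
  then obtain c where c: "\<And>x r. f x $ r = c (p r) * x $ r" by auto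
  have "f \<in> block_algebra p"
    using linear_diagonal[of f "\<lambda>r. c (p r)", OF c]
    by (auto simp: block_algebra_def matrix_nth c axis_def)
  moreover have "f (h x) $ r = h (f x) $ r" if h: "h \<in> block_algebra p" for h x r
  proof -
    have lin: "Vector_Spaces.linear (*s) (*s) h"
      using h by (simp add: block_algebra_def)
    have eq: "matrix h $ r $ s * c (p s) = c (p r) * matrix h $ r $ s" for s
      using h by (cases "p r = p s") (auto simp: block_algebra_def)
    have "h (f x) $ r = (\<Sum>s\<in>UNIV. matrix h $ r $ s * c (p s) * x $ s)"
      by (simp add: c linear_nth[OF lin] mult.assoc)
    also have "\<dots> = f (h x) $ r"
      by (simp only: eq c linear_nth[OF lin] sum_distrib_left mult.assoc)
    finally show ?thesis ..
  qed
  ultimately show "f \<in> center (block_algebra p)"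
    by (simp add: center_def fun_eq_iff vec_eq_iff)
qed

lemma subspace_center_block_algebra:
  "endo.subspace (center (block_algebra p) :: 'k::finite endo set)"
proof (rule endo.subspaceI)
  show "0 \<in> center (block_algebra p)"
    by (auto simp: center_block_algebra intro: exI[of _ "\<lambda>_. 0"])
next
  fix f g :: "'k endo" assume "f \<in> center (block_algebra p)" "g \<in> center (block_algebra p)"
  then obtain a b where "\<And>x r. f x $ r = a (p r) * x $ r" "\<And>x r. g x $ r = b (p r) * x $ r"
    by (auto simp: center_block_algebra)
  then show "f + g \<in> center (block_algebra p)"
    by (auto simp: center_block_algebra algebra_simps intro!: exI[of _ "\<lambda>c. a c + b c"])
next
  fix z and f :: "'k endo" assume "f \<in> center (block_algebra p)"
  then obtain a where "\<And>x r. f x $ r = a (p r) * x $ r"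
    by (auto simp: center_block_algebra)
  then show "scale_endo z f \<in> center (block_algebra p)"
    by (auto simp: center_block_algebra scale_endo_def intro!: exI[of _ "\<lambda>c. z * a c"])
qed

text \<open>
  A label outside the range of \<open>p\<close> would contribute the zero endomorphism, which has no place in
  a basis; hence the index set \<open>range p\<close>.
\<close>

lemma basis_center_block_algebra:
  fixes p :: "'k::finite pattern \<Rightarrow> 'c"
  shows "is_basis (block_projection p ` range p) (center (block_algebra p))"
proof -
  let ?B = "block_projection p ` range p"
  have sub: "?B \<subseteq> center (block_algebra p)"
    by (auto simp: center_block_algebra block_projection_nth
        intro: exI[of _ "\<lambda>a. if a = c then 1 else 0" for c])
  have inj: "inj_on (block_projection p) (range p)"
  proof (rule inj_onI, clarify)
    fix r s assume "block_projection p (p r) = block_projection p (p s)"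
    then have "block_projection p (p r) (axis r 1) $ r = block_projection p (p s) (axis r 1) $ r"
      by simp
    then show "p r = p s" by (simp add: block_projection_nth split: if_splits)
  qed
  have "endo.independent ?B"
  proof (rule endo.independent_if_scalars_zero)
    fix a and e :: "'k endo"
    assume 0: "(\<Sum>e\<in>?B. scale_endo (a e) e) = 0" and "e \<in> ?B"
    then obtain r where e: "e = block_projection p (p r)" by auto
    have "0 = (\<Sum>e\<in>?B. scale_endo (a e) e) (axis r 1) $ r"
      by (simp add: 0)
    also have "\<dots> = (\<Sum>c\<in>range p. if c = p r then a (block_projection p c) else 0)"
      unfolding sum.reindex[OF inj] sum_endo_apply sum_component
      by (intro sum.cong refl) (auto simp: scale_endo_def block_projection_nth axis_def)
    finally show "a e = 0" by (simp add: e)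
  qed simp
  moreover have "f \<in> endo.span ?B" if f: "f \<in> center (block_algebra p)" for f
  proof -
    obtain a where a: "\<And>x r. f x $ r = a (p r) * x $ r"
      using f by (auto simp: center_block_algebra)
    have "f x $ r = (\<Sum>c\<in>range p. scale_endo (a c) (block_projection p c)) x $ r" for x r
    proof -
      have "f x $ r = (\<Sum>c\<in>range p. if c = p r then a c * x $ r else 0)"
        by (simp add: a)
      also have "\<dots> = (\<Sum>c\<in>range p. scale_endo (a c) (block_projection p c)) x $ r"
        unfolding sum_endo_apply sum_component
        by (intro sum.cong refl) (auto simp: scale_endo_def block_projection_nth)
      finally show ?thesis .
    qed
    then have "f = (\<Sum>c\<in>range p. scale_endo (a c) (block_projection p c))"
      by (simp add: fun_eq_iff vec_eq_iff)
    moreover have "(\<Sum>c\<in>range p. scale_endo (a c) (block_projection p c)) \<in> endo.span ?B"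
      by (intro endo.span_sum endo.span_scale endo.span_base imageI)
    ultimately show ?thesis by simp
  qed
  ultimately show ?thesis
    using sub endo.span_minimal[OF sub subspace_center_block_algebra]
    by (auto simp: is_basis_def)
qed

section \<open>The centralizer of the cyclic group\<close>

lemma power_int_eq_1_iff:
  assumes "primitive_root n \<zeta>"
  shows "\<zeta> powi a = 1 \<longleftrightarrow> int n dvd a"
proof -
  have n: "0 < n" "\<zeta> ^ n = 1" and min: "\<And>m. 0 < m \<Longrightarrow> m < n \<Longrightarrow> \<zeta> ^ m \<noteq> 1"
    using assms by (auto simp: primitive_root_def)
  then have nz: "\<zeta> \<noteq> 0" by (auto simp: zero_power)
  define m where "m = nat (a mod int n)"
  have m: "m < n" "int m = a mod int n"
    using n(1) by (auto simp: m_def nat_less_iff)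
  have "a = int n * (a div int n) + int m"
    using m by simp
  then have "\<zeta> powi a = \<zeta> powi (int n * (a div int n)) * \<zeta> powi int m"
    using nz by (metis power_int_add)
  also have "\<zeta> powi (int n * (a div int n)) = 1"
    by (subst power_int_mult) (simp add: n)
  finally have "\<zeta> powi a = \<zeta> ^ m" by simp
  moreover have "\<zeta> ^ m = 1 \<longleftrightarrow> m = 0"
    using min[of m] m by auto
  ultimately show ?thesis
    using m by (simp add: dvd_eq_mod_eq_0 flip: m(2))
qed

lemma power_int_eq_iff_cong:
  assumes "primitive_root n \<zeta>"
  shows "\<zeta> powi a = \<zeta> powi b \<longleftrightarrow> [a = b] (mod int n)"
proof -
  have nz: "\<zeta> \<noteq> 0"
    using assms by (auto simp: primitive_root_def zero_power)
  then have "\<zeta> powi a = \<zeta> powi b \<longleftrightarrow> \<zeta> powi (a - b) = 1"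
    by (simp add: power_int_diff)
  then show ?thesis
    by (simp add: power_int_eq_1_iff[OF assms] cong_iff_dvd_diff)
qed

text \<open>For even \<open>n\<close> one cancels the \<open>2\<close>; for odd \<open>n\<close> it is invertible modulo \<open>n\<close>.\<close>

lemma dvd_double_iff: "int n dvd 2 * x \<longleftrightarrow> int (ntilde n) dvd x"
proof (cases "even n")
  case True
  then obtain m where "n = 2 * m" by blast
  then show ?thesis by (simp add: ntilde_def)
next
  case False
  then have "coprime (int n) 2"
    by (simp add: coprime_commute)
  then show ?thesis using False by (simp add: ntilde_def coprime_dvd_mult_right_iff)
qed

lemma cong_shift_double_iff:
  "[K - 2 * int a = K - 2 * int b] (mod int n) \<longleftrightarrow> [a = b] (mod ntilde n)"
proof -
  have "[K - 2 * int a = K - 2 * int b] (mod int n) \<longleftrightarrow> int n dvd 2 * (int b - int a)"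
    by (simp add: cong_iff_dvd_diff right_diff_distrib)
  also have "\<dots> \<longleftrightarrow> [int b = int a] (mod int (ntilde n))"
    by (simp only: dvd_double_iff cong_iff_dvd_diff)
  finally show ?thesis
    by (auto simp: cong_int_iff cong_sym_eq)
qed

text \<open>
  Each of the \<open>|r|\<close> factors \<open>v\<^sub>-\<^sub>1\<close> of \<open>v\<^sub>r\<close> contributes \<open>x\<inverse>\<close> and each of the
  other \<open>k - |r|\<close> factors contributes \<open>x\<close>.
\<close>

lemma diag_act_cyc_gen:
  fixes y :: "'k::finite tensor"
  assumes "x \<noteq> 0"
  shows "diag_act (cyc_gen x) y $ r = x powi (int CARD('k) - 2 * int (weight r)) * y $ r"
proof -
  define d where "d j = (case j of MinusOne \<Rightarrow> inverse x | PlusOne \<Rightarrow> x)" for j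
  have "(\<Prod>i\<in>UNIV. cyc_gen x $ r i $ s i) = (if r = s then \<Prod>i\<in>UNIV. d (r i) else 0)" for s
  proof (cases "r = s")
    case False
    then obtain i where "r i \<noteq> s i" by blast
    then have "cyc_gen x $ r i $ s i = 0" by (simp add: cyc_gen_def)
    with False show ?thesis by (auto intro: prod_zero)
  qed (simp add: cyc_gen_def d_def)
  then have "diag_act (cyc_gen x) y $ r = (\<Prod>i\<in>UNIV. d (r i)) * y $ r"
    by (simp add: diag_act_def matrix_vector_mult_def if_distrib[of "\<lambda>z. z * _"] cong: if_cong)
  also have "(\<Prod>i\<in>UNIV. d (r i)) = (\<Prod>i | r i = MinusOne. d (r i)) * (\<Prod>i\<in>-{i. r i = MinusOne}. d (r i))"
    by (subst prod.union_disjoint[symmetric]) (auto intro!: prod.cong)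
  also have "(\<Prod>i | r i = MinusOne. d (r i)) = inverse x ^ weight r"
    by (simp add: d_def weight_def)
  also have "(\<Prod>i\<in>-{i. r i = MinusOne}. d (r i)) = (\<Prod>i\<in>-{i. r i = MinusOne}. x)"
    by (intro prod.cong refl) (auto simp: d_def split: sign.split)
  also have "\<dots> = x ^ (CARD('k) - weight r)"
    by (simp add: weight_def Compl_eq_Diff_UNIV card_Diff_subset)
  also have "inverse x ^ weight r * x ^ (CARD('k) - weight r)
      = x powi (- int (weight r)) * x powi (int (CARD('k) - weight r))"
    by (simp add: power_int_minus power_inverse)
  also have "\<dots> = x powi (- int (weight r) + int (CARD('k) - weight r))"
    by (rule power_int_add[symmetric]) (use assms in simp)
  also have "- int (weight r) + int (CARD('k) - weight r) = int CARD('k) - 2 * int (weight r)"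
    using card_mono[of UNIV "{i. r i = MinusOne}"] by (simp add: weight_def of_nat_diff)
  finally show ?thesis .
qed

lemma cyc_eq_powers:
  assumes "primitive_root n \<zeta>"
  shows "cyc \<zeta> = range (\<lambda>m. cyc_gen (\<zeta> ^ m))"
proof -
  interpret group SU2 by (rule group_SU2)
  have n: "0 < n" "\<zeta> ^ n = 1"
    using assms by (auto simp: primitive_root_def)
  have "norm \<zeta> = 1"
    using n by (metis norm_ge_zero norm_one norm_power power_eq_1_iff gr0_implies_Suc nat.distinct(1))
  then have g: "cyc_gen \<zeta> \<in> carrier SU2" by (rule cyc_gen_in_SU2)
  have "ord (cyc_gen \<zeta>) = n"
    using generate_pow_card[OF g] card_cyc[OF assms] by (simp add: cyc_def)
  with n g show ?thesis
    by (auto simp: cyc_def generate_pow_nat cyc_gen_pow)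
qed

text \<open>
  Commuting with the generator multiplies the \<open>(r, s)\<close> entry on one side by the eigenvalue at \<open>r\<close>
  and on the other side by the eigenvalue at \<open>s\<close>, so the entry vanishes when these differ.
  When they agree, so do their powers, which are the eigenvalues of all other group elements.
\<close>

lemma End_cyc_eq_block_algebra:
  assumes "primitive_root n \<zeta>"
  shows "End_cyc \<zeta> = block_algebra (\<lambda>r :: 'k::finite pattern. weight r mod ntilde n)"
proof (intro equalityI subsetI)
  have nz: "\<zeta> \<noteq> 0"
    using assms by (auto simp: primitive_root_def zero_power)
  define e where "e r = int CARD('k) - 2 * int (weight r)" for r :: "'k pattern"
  have act: "diag_act (cyc_gen (\<zeta> ^ m)) y $ r = (\<zeta> powi e r) ^ m * y $ r"
    for m y and r :: "'k pattern"
  proof -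
    have "(\<zeta> ^ m) powi a = (\<zeta> powi a) ^ m" for a
      by (simp add: power_int_power power_int_power' mult.commute)
    with nz show ?thesis by (simp add: diag_act_cyc_gen e_def)
  qed
  have e_eq: "\<zeta> powi e r = \<zeta> powi e s \<longleftrightarrow> weight r mod ntilde n = weight s mod ntilde n" for r s
    unfolding power_int_eq_iff_cong[OF assms] e_def cong_shift_double_iff by (simp add: cong_def)
  {
    fix f :: "'k endo" assume f: "f \<in> End_cyc \<zeta>"
    then have lin: "Vector_Spaces.linear (*s) (*s) f" by (simp add: End_cyc_def)
    have "matrix f $ r $ s = 0" if "weight r mod ntilde n \<noteq> weight s mod ntilde n" for r s
    proof -
      have "cyc_gen \<zeta> \<in> cyc \<zeta>"
        unfolding cyc_eq_powers[OF assms] by (rule image_eqI[of _ _ 1]) auto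
      then have comm: "f (diag_act (cyc_gen \<zeta>) (axis s 1)) $ r = diag_act (cyc_gen \<zeta>) (f (axis s 1)) $ r"
        using f by (auto simp: End_cyc_def fun_eq_iff)
      have "diag_act (cyc_gen \<zeta>) (axis s 1) = \<zeta> powi e s *s axis s 1"
        using act[of 1] by (auto simp: vec_eq_iff axis_def)
      with comm have "\<zeta> powi e s * matrix f $ r $ s = \<zeta> powi e r * matrix f $ r $ s"
        using act[of 1 "f (axis s 1)" r] lin by (simp add: matrix_nth linear_vec_iff)
      then show ?thesis using that e_eq by auto
    qed
    with lin show "f \<in> block_algebra (\<lambda>r. weight r mod ntilde n)"
      by (simp add: block_algebra_def)
  next
    fix f :: "'k endo" assume f: "f \<in> block_algebra (\<lambda>r. weight r mod ntilde n)"
    then have lin: "Vector_Spaces.linear (*s) (*s) f" by (simp add: block_algebra_def)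
    have "f (diag_act (cyc_gen (\<zeta> ^ m)) x) $ r = diag_act (cyc_gen (\<zeta> ^ m)) (f x) $ r" for m x r
    proof -
      have eq: "matrix f $ r $ s * (\<zeta> powi e s) ^ m = (\<zeta> powi e r) ^ m * matrix f $ r $ s" for s
        using f e_eq[of r s] by (cases "\<zeta> powi e r = \<zeta> powi e s") (auto simp: block_algebra_def)
      have "f (diag_act (cyc_gen (\<zeta> ^ m)) x) $ r
          = (\<Sum>s\<in>UNIV. matrix f $ r $ s * (\<zeta> powi e s) ^ m * x $ s)"
        by (simp add: act linear_nth[OF lin] mult.assoc)
      also have "\<dots> = diag_act (cyc_gen (\<zeta> ^ m)) (f x) $ r"
        by (simp only: eq act linear_nth[OF lin] sum_distrib_left mult.assoc)
      finally show ?thesis .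
    qed
    with lin show "f \<in> End_cyc \<zeta>"
      by (auto simp: End_cyc_def cyc_eq_powers[OF assms] fun_eq_iff vec_eq_iff)
  }
qed

lemma card_weight_eq: "card {r :: 'k::finite pattern. weight r = a} = CARD('k) choose a"
proof -
  have "bij_betw (\<lambda>r. {i. r i = MinusOne}) {r :: 'k pattern. weight r = a} {S. S \<subseteq> UNIV \<and> card S = a}"
    by (rule bij_betw_byWitness[where f' = "\<lambda>S i. if i \<in> S then MinusOne else PlusOne"])
      (auto simp: weight_def fun_eq_iff intro: sign.exhaust)
  then show ?thesis
    using n_subsets[of "UNIV :: 'k set" a] by (simp add: bij_betw_same_card)
qed

lemma range_weight: "range (weight :: 'k::finite pattern \<Rightarrow> nat) = {0..CARD('k)}"
proof (intro equalityI subsetI)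
  fix a assume "a \<in> {0..CARD('k)}"
  then have "card {r :: 'k pattern. weight r = a} > 0"
    by (simp add: card_weight_eq)
  then show "a \<in> range (weight :: 'k pattern \<Rightarrow> nat)"
    by (auto simp: card_gt_0_iff)
qed (auto simp: weight_def intro: card_mono)

text \<open>
  Doubling identifies residues \<open>a\<close> modulo \<open>ntilde n\<close> with the residues \<open>l \<equiv> k - 2a\<close> modulo \<open>n\<close>.
  The numbers \<open>a \<le> k\<close> that define \<open>Lambda\<close> are precisely the weights of patterns.
\<close>

lemma central_elt_image_Lambda:
  assumes "n \<ge> 1"
  shows "central_elt n ` Lambda n CARD('k::finite)
    = block_projection (\<lambda>r :: 'k pattern. weight r mod ntilde n) ` range (\<lambda>r :: 'k pattern. weight r mod ntilde n)"
    (is "?L = ?R")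
proof -
  let ?K = "int CARD('k)"
  have elt: "(central_elt n l :: 'k endo) = block_projection (\<lambda>r. weight r mod ntilde n) (weight s mod ntilde n)"
    if "[int l = ?K - 2 * int (weight s)] (mod int n)" for l and s :: "'k pattern"
  proof -
    have "[?K - 2 * int (weight r) = int l] (mod int n) \<longleftrightarrow> [weight r = weight s] (mod ntilde n)"
      for r :: "'k pattern"
      using that by (metis cong_shift_double_iff cong_sym cong_trans)
    then show ?thesis
      by (simp add: central_elt_def block_projection_def cong_def)
  qed
  show ?thesis
  proof (intro equalityI subsetI)
    fix z assume "z \<in> ?L"
    then obtain l a where z: "z = central_elt n l" and a: "a \<in> {0..CARD('k)}"
      and l: "[int l = ?K - 2 * int a] (mod int n)"
      by (auto simp: Lambda_def)
    from a obtain s :: "'k pattern" where "a = weight s"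
      unfolding range_weight[symmetric] by auto
    with z l elt show "z \<in> ?R" by auto
  next
    fix z assume "z \<in> ?R"
    then obtain s :: "'k pattern"
      where z: "z = block_projection (\<lambda>r. weight r mod ntilde n) (weight s mod ntilde n)"
      by auto
    define l where "l = nat ((?K - 2 * int (weight s)) mod int n)"
    have l: "int l = (?K - 2 * int (weight s)) mod int n" "l < n"
      using assms by (auto simp: l_def nat_less_iff)
    then have cong: "[int l = ?K - 2 * int (weight s)] (mod int n)"
      by (simp add: cong_def)
    have "weight s \<in> {0..CARD('k)}"
      unfolding range_weight[symmetric] by simp
    then have "l \<in> Lambda n CARD('k)"
      using l(2) cong unfolding Lambda_def by auto
    moreover have "z = central_elt n l" by (simp add: z elt[OF cong])
    ultimately show "z \<in> ?L" by (rule rev_image_eqI)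
  qed
qed

section \<open>Binomial sums, cyclic polynomials and closed walks\<close>

lemma card_congruent_weights:
  "card {(r :: 'k::finite pattern, s :: 'k pattern). weight r mod m = weight s mod m} = binom_sum m CARD('k)"
proof -
  let ?W = "\<lambda>a. {r :: 'k pattern. weight r = a}"
  define I where "I = {(a, b). a \<le> CARD('k) \<and> b \<le> CARD('k) \<and> [a = b] (mod m)}"
  have fin: "finite I"
    by (rule finite_subset[of _ "{..CARD('k)} \<times> {..CARD('k)}"]) (auto simp: I_def)
  have le: "weight r \<le> CARD('k)" for r :: "'k pattern"
    using range_weight[where 'k = 'k] by auto
  have "{(r :: 'k pattern, s :: 'k pattern). weight r mod m = weight s mod m} = (\<Union>(a, b)\<in>I. ?W a \<times> ?W b)"
    using le by (auto simp: cong_def I_def)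
  also have "card \<dots> = (\<Sum>(a, b)\<in>I. card (?W a \<times> ?W b))"
    unfolding case_prod_unfold by (rule card_UN_disjoint) (use fin in \<open>auto\<close>)
  also have "\<dots> = binom_sum m CARD('k)"
    by (simp add: binom_sum_def I_def card_cartesian_product card_weight_eq)
  finally show ?thesis .
qed

text \<open>
  Vandermonde's identity expands \<open>2k choose j\<close> over the pairs \<open>(a, j - a)\<close>.  The substitution
  \<open>b = k - (j - a)\<close>, under which \<open>k choose (j - a)\<close> becomes \<open>k choose b\<close>, turns the
  condition \<open>j \<equiv> k\<close> into \<open>a \<equiv> b\<close>.
\<close>

lemma binom_sum_eq_sum_choose:
  "binom_sum m k = (\<Sum>j | j \<le> 2 * k \<and> [j = k] (mod m). (2 * k) choose j)"
proof -
  let ?J = "{j. j \<le> 2 * k \<and> [j = k] (mod m)}"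
  let ?I = "{(a, b). a \<le> k \<and> b \<le> k \<and> [a = b] (mod m)}"
  let ?S = "Sigma ?J (\<lambda>j. {..j})"
  let ?S' = "{(j, a). (j, a) \<in> ?S \<and> a \<le> k \<and> j - a \<le> k}"
  have fin: "finite ?S" by auto
  have cong: "[a + k - b = k] (mod m) \<longleftrightarrow> [a = b] (mod m)" if "b \<le> k" for a b
  proof -
    have "[a + k - b = k] (mod m) \<longleftrightarrow> [(a + k - b) + b = k + b] (mod m)"
      by (rule cong_add_rcancel_nat[symmetric])
    also have "(a + k - b) + b = a + k" using that by simp
    also have "[a + k = k + b] (mod m) \<longleftrightarrow> [a = b] (mod m)"
      by (metis add.commute cong_add_rcancel_nat)
    finally show ?thesis .
  qed
  have "(\<Sum>j\<in>?J. (2 * k) choose j) = (\<Sum>j\<in>?J. \<Sum>a\<le>j. (k choose a) * (k choose (j - a)))"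
    by (simp add: vandermonde mult_2)
  also have "\<dots> = (\<Sum>(j, a)\<in>?S. (k choose a) * (k choose (j - a)))"
    by (rule sum.Sigma) auto
  \<comment> \<open>The vanishing terms must go first: for \<open>j - a > k\<close> the truncated difference
      \<open>a + k - j\<close> no longer determines \<open>j\<close>.\<close>
  also have "\<dots> = (\<Sum>(j, a)\<in>?S'. (k choose a) * (k choose (j - a)))"
    by (rule sum.mono_neutral_right[OF fin]) auto
  also have "\<dots> = (\<Sum>(a, b)\<in>?I. (k choose a) * (k choose b))"
  proof (rule sum.reindex_bij_witness[
        where i = "\<lambda>(a, b). (a + k - b, a)" and j = "\<lambda>(j, a). (a, a + k - j)"])
    show "(case (case q of (j, a) \<Rightarrow> (a, a + k - j)) of (a, b) \<Rightarrow> (k choose a) * (k choose b))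
        = (case q of (j, a) \<Rightarrow> (k choose a) * (k choose (j - a)))" if "q \<in> ?S'" for q
    proof -
      obtain j a where q: "q = (j, a)" by (cases q)
      with that have "j - a \<le> k" "a + k - j = k - (j - a)" by auto
      then show ?thesis using binomial_symmetric[of "j - a" k] by (simp add: q)
    qed
    show "(case q of (j, a) \<Rightarrow> (a, a + k - j)) \<in> ?I" if "q \<in> ?S'" for q
    proof -
      obtain j a where q: "q = (j, a)" by (cases q)
      with that have "a + k - j \<le> k" "a + k - (a + k - j) = j" by auto
      with that q cong[of "a + k - j" a] show ?thesis by auto
    qed
  qed (use cong in auto)
  finally show ?thesis by (simp add: binom_sum_def)
qed

lemma binomial_poly:
  "[:1, 1:] ^ N = (\<Sum>j\<le>N. Polynomial.monom (of_nat (N choose j)) j :: complex poly)"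
proof -
  have "[:1, 1:] = Polynomial.monom 1 1 + (1 :: complex poly)"
    by (simp add: monom_altdef one_pCons)
  moreover have "of_nat (N choose j) * Polynomial.monom 1 1 ^ j * 1 ^ (N - j)
      = (Polynomial.monom (of_nat (N choose j)) j :: complex poly)" for j
    by (simp add: monom_power of_nat_poly smult_monom)
  ultimately show ?thesis
    by (simp only: binomial_ring)
qed

text \<open>Multiplying \<open>z\<^sup>m - 1\<close> by \<open>c z\<^bsup>j - m\<^esup>\<close> shows that the exponent \<open>j\<close> may be lowered by \<open>m\<close>.\<close>

lemma monom_mod_cyclic:
  fixes c :: "'a::field"
  assumes "m \<ge> 1"
  shows "Polynomial.monom c j mod (Polynomial.monom 1 m - 1) = Polynomial.monom c (j mod m)"
proof (induction j rule: less_induct)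
  case (less j)
  let ?Q = "Polynomial.monom 1 m - 1 :: 'a poly"
  have deg: "Polynomial.degree ?Q = m"
    using degree_add_eq_left[of "-1" "Polynomial.monom 1 m :: 'a poly"] assms
    by (simp add: degree_monom_eq)
  show ?case
  proof (cases "j < m")
    case True
    then have "Polynomial.degree (Polynomial.monom c j) < Polynomial.degree ?Q"
      unfolding deg using degree_monom_le[of c j] by (rule le_less_trans[rotated])
    with True show ?thesis by (simp add: mod_poly_less)
  next
    case False
    then have "Polynomial.monom c j = Polynomial.monom c (j - m) + Polynomial.monom c (j - m) * ?Q"
      by (simp add: algebra_simps mult_monom)
    then have "Polynomial.monom c j mod ?Q = Polynomial.monom c (j - m) mod ?Q"
      by (metis mod_mult_self2 mult.commute)
    also have "\<dots> = Polynomial.monom c (j mod m)"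
      using less[of "j - m"] False assms by (simp add: le_mod_geq)
    finally show ?thesis .
  qed
qed

lemma poly_mod_sum: "(\<Sum>i\<in>I. f i) mod q = (\<Sum>i\<in>I. f i mod (q :: 'a::field poly))"
  by (induction I rule: infinite_finite_induct) (simp_all add: poly_mod_add_left)

lemma coeff_cyclic_binomial:
  assumes "m \<ge> 1"
  shows "coeff_cyclic m ([:1, 1:] ^ (2 * k)) k = of_nat (binom_sum m k)"
proof -
  have "coeff_cyclic m ([:1, 1:] ^ (2 * k)) k
      = (\<Sum>j\<le>2 * k. if [j = k] (mod m) then of_nat ((2 * k) choose j) else 0)"
    by (simp add: coeff_cyclic_def binomial_poly poly_mod_sum monom_mod_cyclic[OF assms]
        Polynomial.coeff_sum Polynomial.coeff_monom cong_def cong: if_cong)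
  also have "\<dots> = of_nat (binom_sum m k)"
    by (simp add: binom_sum_eq_sum_choose sum.inter_filter[symmetric])
  finally show ?thesis .
qed

definition step_lists :: "nat \<Rightarrow> nat \<Rightarrow> int list set" where
  "step_lists m j = {ds. length ds = m \<and> set ds \<subseteq> {-1, 1} \<and> count_list ds (-1) = j}"

lemma finite_step_lists: "finite (step_lists m j)"
  by (rule finite_subset[OF _ finite_lists_length_eq[of "{-1, 1}" m]]) (auto simp: step_lists_def)

lemma card_step_lists: "card (step_lists m j) = m choose j"
proof (induction m arbitrary: j)
  case 0
  have "step_lists 0 j = (if j = 0 then {[]} else {})"
    by (auto simp: step_lists_def)
  then show ?case by (cases j) simp_all
next
  case (Suc m)
  have split: "step_lists (Suc m) j = (#) 1 ` step_lists m j \<union>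
      (if j = 0 then {} else (#) (-1) ` step_lists m (j - 1))"
    by (auto simp: step_lists_def length_Suc_conv)
  have card: "card ((#) c ` step_lists m i) = m choose i" for c i
    by (simp add: card_image Suc)
  show ?case
  proof (cases j)
    case (Suc i)
    have "card (step_lists (Suc m) j)
        = card ((#) 1 ` step_lists m j) + card ((#) (-1) ` step_lists m i)"
      unfolding split by (subst card_Un_disjoint[symmetric]) (auto simp: finite_step_lists Suc)
    then show ?thesis by (simp add: card Suc)
  next
    case 0
    with split have "step_lists (Suc m) j = (#) 1 ` step_lists m j" by simp
    with 0 show ?thesis by (simp only: card) simp
  qed
qed

lemma sum_list_steps:
  assumes "set ds \<subseteq> {-1, 1 :: int}"
  shows "sum_list ds = int (length ds) - 2 * int (count_list ds (-1))"
  using assms by (induction ds) auto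

lemma foldl_circle_step:
  "foldl (circle_step n) (i mod int n) ds = (i + sum_list ds) mod int n"
  by (induction ds arbitrary: i) (simp_all add: circle_step_def mod_add_left_eq add.assoc)

text \<open>
  The endpoint of a walk depends only on its number \<open>j\<close> of negative steps, and \<open>2k choose j\<close>
  walks have that number.
\<close>

lemma card_closed_walks: "card (circle_walks n (2 * k) 0 0) = binom_sum (ntilde n) k"
proof -
  let ?J = "{j. j \<le> 2 * k \<and> [j = k] (mod ntilde n)}"
  have closed: "foldl (circle_step n) 0 ds = 0 \<longleftrightarrow> [count_list ds (-1) = k] (mod ntilde n)"
    if "length ds = 2 * k" "set ds \<subseteq> {-1, 1}" for ds
  proof -
    have "foldl (circle_step n) 0 ds = 0 \<longleftrightarrow> [2 * int k - 2 * int (count_list ds (-1)) = 2 * int k - 2 * int k] (mod int n)"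
      using foldl_circle_step[of n 0 ds] that by (simp add: sum_list_steps cong_def)
    then show ?thesis by (simp only: cong_shift_double_iff)
  qed
  have "circle_walks n (2 * k) 0 0 = (\<Union>j\<in>?J. step_lists (2 * k) j)"
  proof (intro equalityI subsetI)
    fix ds :: "int list"
    assume "ds \<in> circle_walks n (2 * k) 0 0"
    then show "ds \<in> (\<Union>j\<in>?J. step_lists (2 * k) j)"
      using closed[of ds] count_le_length[of ds "-1"]
      by (auto simp: circle_walks_def step_lists_def)
  qed (use closed in \<open>auto simp: circle_walks_def step_lists_def\<close>)
  also have "card \<dots> = (\<Sum>j\<in>?J. card (step_lists (2 * k) j))"
    by (rule card_UN_disjoint) (auto simp: finite_step_lists, auto simp: step_lists_def)
  also have "\<dots> = binom_sum (ntilde n) k"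
    by (simp add: card_step_lists binom_sum_eq_sum_choose)
  finally show ?thesis .
qed

section \<open>Structure and dimension of the centralizer\<close>

theorem theorem2p8:
  fixes n k :: nat and \<zeta> :: complex
  assumes "n \<ge> 1" and "k = CARD('k::finite)" and "primitive_root n \<zeta>"
  shows "is_basis {matrix_unit r s | r s. [weight r = weight s] (mod ntilde n)} (End_cyc \<zeta> :: 'k endo set)
    \<and> is_basis (central_elt n ` Lambda n k) (center (End_cyc \<zeta> :: 'k endo set))
    \<and> (n = 2 * ntilde n \<and> odd (ntilde n) \<longrightarrow>
        (\<forall>\<xi>. primitive_root (ntilde n) \<xi> \<longrightarrow> alg_iso (End_cyc \<zeta> :: 'k endo set) (End_cyc \<xi>)))
    \<and> of_nat (endo.dim (End_cyc \<zeta> :: 'k endo set)) = coeff_cyclic (ntilde n) ([:1, 1:] ^ (2 * k)) k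
    \<and> endo.dim (End_cyc \<zeta> :: 'k endo set) = binom_sum (ntilde n) k
    \<and> card (circle_walks n (2 * k) 0 0) = binom_sum (ntilde n) k"
proof (intro conjI impI allI)
  let ?p = "\<lambda>r :: 'k pattern. weight r mod ntilde n"
  note E = End_cyc_eq_block_algebra[OF assms(3), where 'k = 'k]
  have nt: "ntilde n \<ge> 1"
    using assms(1) by (auto simp: ntilde_def elim!: evenE)
  show "is_basis {matrix_unit r s | r s. [weight r = weight s] (mod ntilde n)} (End_cyc \<zeta> :: 'k endo set)"
    using basis_block_algebra[of ?p] by (simp add: E cong_def)
  show "is_basis (central_elt n ` Lambda n k) (center (End_cyc \<zeta> :: 'k endo set))"
    using basis_center_block_algebra[of ?p]
    by (simp add: E assms(2) central_elt_image_Lambda[OF assms(1)])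
  show dim: "endo.dim (End_cyc \<zeta> :: 'k endo set) = binom_sum (ntilde n) k"
    by (simp add: E dim_block_algebra card_congruent_weights assms(2))
  show "of_nat (endo.dim (End_cyc \<zeta> :: 'k endo set)) = coeff_cyclic (ntilde n) ([:1, 1:] ^ (2 * k)) k"
    by (simp add: dim coeff_cyclic_binomial[OF nt])
  show "card (circle_walks n (2 * k) 0 0) = binom_sum (ntilde n) k"
    by (rule card_closed_walks)
  fix \<xi> assume "n = 2 * ntilde n \<and> odd (ntilde n)" and \<xi>: "primitive_root (ntilde n) \<xi>"
  then have "ntilde (ntilde n) = ntilde n"
    by (simp add: ntilde_def)
  then have "(End_cyc \<xi> :: 'k endo set) = End_cyc \<zeta>"
    by (simp add: E End_cyc_eq_block_algebra[OF \<xi>])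
  then show "alg_iso (End_cyc \<zeta> :: 'k endo set) (End_cyc \<xi>)"
    by (auto simp: alg_iso_def intro: exI[of _ id])
qed

end
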